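(* Let $\mathrm{K}$ be the class of all subgroups of the group $G=\mathbb{Q}/\mathbb{Z}$, with generator distance $d_{\mathfrak{g}}$ computed in $\mathrm{K}$. Let $\bar{k}$ and $\bar{k}'$ be two choice sequences. 1. If $\bar{k}=\bar{k}'$, then $d_{\mathfrak{g}}(\langle\bar{k}\rangle,\langle\bar{k}'\rangle)=0$. 2. If $\bar{k}\preceq\bar{k}'$ and $\bar{k}\neq\bar{k}'$, then $d_{\mathfrak{g}}(\langle\bar{k}\rangle,\langle\bar{k}'\rangle)=1$. 3. If $\bar{k}\equiv\bar{k}'$, $\bar{k}\not\preceq\bar{k}'$ and $\bar{k}'\not\preceq\bar{k}$, then $d_{\mathfrak{g}}(\langle\bar{k}\rangle,\langle\bar{k}'\rangle)=2$. 4. If $\bar{k}\not\equiv\bar{k}'$, then $d_{\mathfrak{g}}(\langle\bar{k}\rangle,\langle\bar{k}'\rangle)=\infty$.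
   Context: Let $p_0,p_1,\ldots$ be the primes in their natural order. For a prime $p$ and $s\in\omega$ (with $0\in\omega$), $Z(p^s)$ denotes the cyclic subgroup of $G=\mathbb{Q}/\mathbb{Z}$ of order $p^s$, and $Z(p^\infty)=\bigcup_{s\in\omega}Z(p^s)$ is the Prüfer $p$-subgroup of $G$. A choice sequence is an infinite sequence $\bar{k}=(k_0,k_1,\ldots)$ where each $k_i$ is a non-negative integer or the symbol $\infty$. $\langle\bar{k}\rangle$ is the subgroup of $G$ consisting of all finite products (in the group operation of $G$) $g_1g_2\cdots g_m$, $0\neq m\in\omega$, with $g_1,\dots,g_m\in\bigcup_{i=0}^\infty Z(p_i^{k_i})$. $\bar{k}\equiv\bar{k}'$ means: for each $i\in\omega$, $k_i=\infty\iff k'_i=\infty$, and the set $\{i\in\omega: k_i\neq k'_i\}$ is finite. $\bar{k}\preceq\bar{k}'$ means: $\bar{k}\equiv\bar{k}'$ and $k_i\le k'_i$ for each $i\in\omega$. For a class $\mathrm{K}$ of groups, a subgroup $H\le H'$ is large in $H'$ if there is $h\in H'$ such that $H\cup\{h\}$ generates $H'$. The network $\mathcal{N}(\mathrm{K})$ is the graph whose vertices are the members of $\mathrm{K}$, with red edges joining isomorphic members and blue edges joining two members if one of them is a large subgroup of the other. A path is a finite sequence of edges in which any two consecutive edges share a common vertex; its blue-length is the number of its blue edges. The generator distance $d_{\mathfrak{g}}(H,H')\in\omega\cup\{\infty\}$ is the minimum blue-length of a path connecting $H$ and $H'$ in $\mathcal{N}(\mathrm{K})$, and is $\infty$ if there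 is no such path. *)

theory Defs
  imports
    "HOL-Algebra.Elementary_Groups"
    "HOL-Algebra.Multiplicative_Group"
    "HOL-Computational_Algebra.Primes"
    "HOL-Library.Infinite_Set"
    "HOL-Library.Extended_Nat"
begin

text \<open>Subgroups are sets in HOL-Algebra, whereas here both \<open>H\<close> and \<open>H'\<close> are groups in their own
  right, so the agreement of the operations has to be demanded explicitly.\<close>

definition is_subgroup_of :: "'a monoid \<Rightarrow> 'a monoid \<Rightarrow> bool" where
  "is_subgroup_of H H' \<longleftrightarrow> subgroup (carrier H) H' \<and>
     (\<forall>x\<in>carrier H. \<forall>y\<in>carrier H. x \<otimes>\<^bsub>H\<^esub> y = x \<otimes>\<^bsub>H'\<^esub> y)"

definition large_subgroup :: "'a monoid \<Rightarrow> 'a monoid \<Rightarrow> bool" where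
  "large_subgroup H H' \<longleftrightarrow> is_subgroup_of H H' \<and>
     (\<exists>h\<in>carrier H'. generate H' (carrier H \<union> {h}) = carrier H')"

text \<open>An edge is a colour together with its set of end vertices, so that two vertices may be joined
  by a red and by a blue edge at the same time.\<close>

datatype colour = Red | Blue

type_synonym 'a edge = "colour \<times> 'a monoid set"

definition network_edges :: "'a monoid set \<Rightarrow> 'a edge set" where
  "network_edges K =
     {(Red, {H, H'}) | H H'. H \<in> K \<and> H' \<in> K \<and> H \<cong> H'} \<union>
     {(Blue, {H, H'}) | H H'. H \<in> K \<and> H' \<in> K \<and> (large_subgroup H H' \<or> large_subgroup H' H)}"

definition network_path :: "'a monoid set \<Rightarrow> 'a edge list \<Rightarrow> bool" where
  "network_path K es \<longleftrightarrow> set es \<subseteq> network_edges K \<and>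
     (\<forall>i. Suc i < length es \<longrightarrow> snd (es ! i) \<inter> snd (es ! Suc i) \<noteq> {})"

text \<open>The empty path joins every vertex to itself; so does a red loop of blue-length \<open>0\<close>, hence this
  convention does not influence the distance.\<close>

definition path_connects :: "'a monoid set \<Rightarrow> 'a edge list \<Rightarrow> 'a monoid \<Rightarrow> 'a monoid \<Rightarrow> bool" where
  "path_connects K es H H' \<longleftrightarrow> network_path K es \<and>
     (if es = [] then H = H' \<and> H \<in> K else H \<in> snd (hd es) \<and> H' \<in> snd (last es))"

definition blue_length :: "'a edge list \<Rightarrow> nat" where
  "blue_length es = length (filter (\<lambda>e. fst e = Blue) es)"

text \<open>In \<^typ>\<open>enat\<close> the infimum of a nonempty set is its minimum, and the infimum of the empty set
  is \<open>\<infinity>\<close>.\<close>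

definition generator_distance :: "'a monoid set \<Rightarrow> 'a monoid \<Rightarrow> 'a monoid \<Rightarrow> enat" where
  "generator_distance K H H' = (INF es\<in>{es. path_connects K es H H'}. enat (blue_length es))"

definition rat_group :: "rat monoid" where
  "rat_group = \<lparr>carrier = UNIV, monoid.mult = (+), one = 0\<rparr>"

definition QmodZ :: "rat set monoid" where
  "QmodZ = rat_group Mod \<int>"

definition all_subgroups :: "'a monoid \<Rightarrow> 'a monoid set" where
  "all_subgroups G = {G\<lparr>carrier := H\<rparr> | H. subgroup H G}"

text \<open>The description is proper for \<open>n > 0\<close>, see \<open>ex1_cyclic_subgroup\<close> below.\<close>

definition cyclic_subgroup :: "nat \<Rightarrow> rat set set" where
  "cyclic_subgroup n =
     (THE H. subgroup H QmodZ \<and> cyclic_group (QmodZ\<lparr>carrier := H\<rparr>) \<and> card H = n)"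

fun Z_sub :: "nat \<Rightarrow> enat \<Rightarrow> rat set set" where
  "Z_sub p (enat s) = cyclic_subgroup (p ^ s)"
| "Z_sub p \<infinity> = (\<Union>s. cyclic_subgroup (p ^ s))"

definition nth_prime :: "nat \<Rightarrow> nat" where
  "nth_prime i = enumerate {p. Factorial_Ring.prime p} i"

type_synonym choice_seq = "nat \<Rightarrow> enat"

definition choice_subgroup :: "choice_seq \<Rightarrow> rat set set" where
  "choice_subgroup k = {foldr (\<lambda>x y. x \<otimes>\<^bsub>QmodZ\<^esub> y) gs \<one>\<^bsub>QmodZ\<^esub> | gs.
     gs \<noteq> [] \<and> set gs \<subseteq> (\<Union>i. Z_sub (nth_prime i) (k i))}"

definition choice_group :: "choice_seq \<Rightarrow> rat set monoid" where
  "choice_group k = QmodZ\<lparr>carrier := choice_subgroup k\<rparr>"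

definition choice_equiv :: "choice_seq \<Rightarrow> choice_seq \<Rightarrow> bool" where
  "choice_equiv k k' \<longleftrightarrow> (\<forall>i. k i = \<infinity> \<longleftrightarrow> k' i = \<infinity>) \<and> finite {i. k i \<noteq> k' i}"

definition choice_le :: "choice_seq \<Rightarrow> choice_seq \<Rightarrow> bool" where
  "choice_le k k' \<longleftrightarrow> choice_equiv k k' \<and> (\<forall>i. k i \<le> k' i)"

lemma comm_group_rat_group: "comm_group rat_group"
  unfolding rat_group_def
  by (rule comm_groupI; simp) (metis add.left_inverse)

lemma inv_rat_group: "inv\<^bsub>rat_group\<^esub> x = - x"
  by (rule group.inv_equality[OF comm_group.axioms(2)[OF comm_group_rat_group]])
    (auto simp: rat_group_def)

lemma subgroup_Ints: "subgroup \<int> rat_group"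
  by (rule group.subgroupI[OF comm_group.axioms(2)[OF comm_group_rat_group]])
    (auto simp: inv_rat_group, auto simp: rat_group_def)

lemma normal_Ints: "\<int> \<lhd> rat_group"
  using comm_group.subgroup_imp_normal[OF comm_group_rat_group subgroup_Ints] .

lemma group_QmodZ: "group QmodZ"
  unfolding QmodZ_def by (rule normal.factorgroup_is_group[OF normal_Ints])

definition coset :: "rat \<Rightarrow> rat set" where
  "coset q = \<int> #>\<^bsub>rat_group\<^esub> q"

lemma coset_eq: "coset q = {x. x - q \<in> \<int>}"
  by (force simp: coset_def r_coset_def rat_group_def)

lemma coset_eq_iff: "coset a = coset b \<longleftrightarrow> a - b \<in> \<int>"
proof
  assume "coset a = coset b"
  then have "a \<in> coset b" unfolding coset_eq by (metis (mono_tags) Ints_0 diff_self mem_Collect_eq)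
  then show "a - b \<in> \<int>" by (simp add: coset_eq)
next
  assume h: "a - b \<in> \<int>"
  have "x - a \<in> \<int> \<longleftrightarrow> x - b \<in> \<int>" for x
    using Ints_add[OF h, of "x - a"] Ints_diff[OF _ h, of "x - b"] by auto
  then show "coset a = coset b" by (simp add: coset_eq)
qed

lemma carrier_QmodZ: "carrier QmodZ = range coset"
  by (auto simp: QmodZ_def FactGroup_def RCOSETS_def coset_def) (auto simp: rat_group_def)

lemma mult_coset: "coset a \<otimes>\<^bsub>QmodZ\<^esub> coset b = coset (a + b)"
  using normal.rcos_sum[OF normal_Ints, of a b]
  by (simp add: QmodZ_def FactGroup_def coset_def rat_group_def)

lemma one_QmodZ: "\<one>\<^bsub>QmodZ\<^esub> = coset 0"
  by (simp add: QmodZ_def FactGroup_def coset_eq)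

lemma pow_coset: "coset a [^]\<^bsub>QmodZ\<^esub> (n::nat) = coset (of_nat n * a)"
  by (induction n) (auto simp: one_QmodZ mult_coset algebra_simps)

lemma inv_coset: "inv\<^bsub>QmodZ\<^esub> (coset a) = coset (- a)"
  by (rule group.inv_equality[OF group_QmodZ]) (auto simp: mult_coset one_QmodZ carrier_QmodZ)

lemma ipow_coset: "coset a [^]\<^bsub>QmodZ\<^esub> (i::int) = coset (of_int i * a)"
  by (cases "i \<ge> 0")
    (auto simp: int_pow_def2 pow_coset inv_coset)

lemma coset_div_eq_mod:
  assumes "n > 0"
  shows "coset (of_int z / of_nat n) = coset (of_nat (nat (z mod int n)) / of_nat n)"
proof -
  have "(of_int z :: rat) = of_int (z div int n) * of_nat n + of_int (z mod int n)"
    by (metis div_mult_mod_eq of_int_add of_int_mult of_int_of_nat_eq)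
  moreover have "(of_nat (nat (z mod int n)) :: rat) = of_int (z mod int n)"
    using assms by (simp add: of_nat_nat)
  ultimately have "(of_int z / of_nat n - of_nat (nat (z mod int n)) / of_nat n :: rat)
      = of_int (z div int n)"
    using assms by (simp add: field_simps)
  then show ?thesis by (simp add: coset_eq_iff)
qed

lemma card_cosets:
  assumes "n > 0"
  shows "card ((\<lambda>i. coset (of_nat i / of_nat n)) ` {..<n}) = n"
proof -
  have "i = j" if "i < n" "j < n" "coset (of_nat i / of_nat n) = coset (of_nat j / of_nat n)" for i j
  proof -
    obtain z where "of_nat i / of_nat n - of_nat j / of_nat n = (of_int z :: rat)"
      using \<open>coset _ = coset _\<close> unfolding coset_eq_iff by (auto elim: Ints_cases)
    then have "(of_nat i - of_nat j :: rat) = of_int z * of_nat n"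
      using assms by (simp add: field_simps)
    then have "(of_int (int i - int j) :: rat) = of_int (z * int n)" by simp
    then have z: "int i - int j = z * int n" by (simp only: of_int_eq_iff)
    then have "int n dvd int i - int j" by simp
    then show "i = j" using that
      by (metis mod_eq_dvd_iff mod_less of_nat_eq_iff of_nat_mod)
  qed
  then have "inj_on (\<lambda>i. coset (of_nat i / of_nat n)) {..<n}" by (auto intro: inj_onI)
  then show ?thesis by (simp add: card_image)
qed

lemma ex1_cyclic_subgroup:
  assumes n: "n > 0"
  shows "\<exists>!H. subgroup H QmodZ \<and> cyclic_group (QmodZ\<lparr>carrier := H\<rparr>) \<and> card H = n"
proof -
  interpret group QmodZ by (rule group_QmodZ)
  define T where "T = (\<lambda>i. coset (of_nat i / of_nat n)) ` {..<n}"
  define c where "c = coset (1 / of_nat n)"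
  have cc: "c \<in> carrier QmodZ" by (simp add: c_def carrier_QmodZ)
  have T: "coset (of_int z / of_nat n) \<in> T" for z
    unfolding coset_div_eq_mod[OF n] T_def by (rule imageI) (use n in \<open>simp add: nat_less_iff\<close>)
  have "generate QmodZ {c} = range (\<lambda>i::int. coset (of_int i / of_nat n))"
    using generate_pow[OF cc] by (auto simp: c_def ipow_coset)
  also have "\<dots> = T"
  proof
    show "range (\<lambda>i::int. coset (of_int i / of_nat n)) \<subseteq> T" using T by auto
    show "T \<subseteq> range (\<lambda>i::int. coset (of_int i / of_nat n))"
      unfolding T_def by (force intro: range_eqI[of _ _ "int _"])
  qed
  finally have gen: "generate QmodZ {c} = T" .
  have sub: "subgroup T QmodZ" using generate_is_subgroup[of "{c}"] cc gen by auto
  have cyc: "cyclic_group (QmodZ\<lparr>carrier := T\<rparr>)"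
    using cyclic_group_generated[of c] cc by (simp add: subgroup_generated_def gen)
  have uniq: "H = T" if H: "subgroup H QmodZ" and card: "card H = n" for H
  proof -
    interpret H: group "QmodZ\<lparr>carrier := H\<rparr>" using subgroup_imp_group[OF H] .
    have "H \<subseteq> T"
    proof
      fix x assume x: "x \<in> H"
      then obtain q where q: "x = coset q" using subgroup.subset[OF H] carrier_QmodZ by auto
      have "x [^]\<^bsub>QmodZ\<lparr>carrier := H\<rparr>\<^esub> n = \<one>\<^bsub>QmodZ\<lparr>carrier := H\<rparr>\<^esub>"
        using H.pow_order_eq_1[of x] x card by (simp add: order_def)
      then have "x [^]\<^bsub>QmodZ\<^esub> n = \<one>\<^bsub>QmodZ\<^esub>" unfolding nat_pow_consistent[symmetric] by simp
      then have "of_nat n * q \<in> \<int>" by (simp add: q pow_coset one_QmodZ coset_eq_iff)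
      then obtain z where "of_nat n * q = of_int z" by (auto elim: Ints_cases)
      then have "q = of_int z / of_nat n" using n by (simp add: field_simps)
      then show "x \<in> T" using T q by simp
    qed
    moreover have "finite T" "card T = n" using card_cosets[OF n] by (auto simp: T_def)
    ultimately show ?thesis using card by (simp add: card_subset_eq)
  qed
  show ?thesis
  proof (intro ex1I[of _ T] conjI)
    show "card T = n" unfolding T_def by (rule card_cosets[OF n])
  qed (use sub cyc uniq in blast)+
qed

end

theory Submission
  imports Defs
begin

text \<open>
  Two isomorphic subgroups of \<open>Q/Z\<close> coincide, since there is only one cyclic subgroup of each order;
  so red edges are loops and the generator distance is the distance in the graph of blue edges.
  If \<open>H\<close> is large in \<open>H'\<close>, then \<open>N H' \<subseteq> H\<close> for the order \<open>N\<close> of the additional generator, hence groups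
  at finite distance are commensurable, and comparing \<open>p\<close>-parts of denominators turns commensurability
  of \<open>\<langle>k\<rangle>\<close> and \<open>\<langle>k'\<rangle>\<close> into \<open>k \<equiv> k'\<close>. Conversely, for \<open>k \<preceq> k'\<close> the finitely many exponents that differ
  are reached by adjoining a single \<open>1/N\<close>, and for \<open>k \<equiv> k'\<close> the pointwise maximum of \<open>k\<close> and \<open>k'\<close>
  lies above both.\<close>

section \<open>Primes and extended naturals\<close>

lemma nth_prime_prime: "Factorial_Ring.prime (nth_prime i)"
  unfolding nth_prime_def using enumerate_in_set[OF primes_infinite] by simp

lemma nth_prime_pos: "nth_prime i > 0"
  using nth_prime_prime prime_gt_0_nat by blast

lemma inj_nth_prime: "inj nth_prime"
  using strict_mono_enumerate[OF primes_infinite] strict_mono_imp_inj_on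
  unfolding nth_prime_def by blast

lemma finite_nth_prime_dvd:
  assumes "n > 0"
  shows "finite {i. nth_prime i dvd n}"
proof -
  have "nth_prime ` {i. nth_prime i dvd n} \<subseteq> {d. d dvd n}" by auto
  then have "finite (nth_prime ` {i. nth_prime i dvd n})"
    using finite_subset finite_divisors_nat[OF assms] by blast
  then show ?thesis using finite_imageD inj_on_subset[OF inj_nth_prime] by blast
qed

text \<open>Reduces bounds between exponents, \<open>\<infinity>\<close> included, to finite
  exponents \<open>s\<close>: a finite \<open>b = enat m\<close> below \<open>a\<close> would
  already fail at \<open>Suc m\<close>.\<close>

lemma enat_le_lower:
  fixes a b :: enat
  assumes "\<And>s. enat s \<le> a \<Longrightarrow> enat s \<le> b"
  shows "a \<le> b"
proof (rule ccontr)
  assume "\<not> a \<le> b"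
  then obtain m where m: "b = enat m" "enat m < a" by (cases b) auto
  then have "enat (Suc m) \<le> a" by (simp add: Suc_ile_eq)
  then show False using assms m(1) by fastforce
qed

section \<open>Paths as walks in the graph of blue edges\<close>

text \<open>A relation rather than a set of edges, so that the relational power
  \<open>blue_adjacent K ^^ m\<close> stands for walks of \<open>m\<close> blue steps.\<close>

definition blue_adjacent :: "'a monoid set \<Rightarrow> 'a monoid \<Rightarrow> 'a monoid \<Rightarrow> bool" where
  "blue_adjacent K A B \<longleftrightarrow> A \<in> K \<and> B \<in> K \<and> (large_subgroup A B \<or> large_subgroup B A)"

lemma network_path_Cons:
  "network_path K (e # es) \<longleftrightarrow>
     e \<in> network_edges K \<and> network_path K es \<and> (es = [] \<or> snd e \<inter> snd (hd es) \<noteq> {})"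
  by (cases es) (auto simp: network_path_def nth_Cons split: nat.splits)

text \<open>The case \<open>A = B\<close> covers red edges, which are loops under
  \<open>iso\<close>, and also a blue edge that a path enters and leaves at the same vertex.\<close>

lemma edge_blue_adjacent:
  assumes iso: "\<forall>A\<in>K. \<forall>B\<in>K. A \<cong> B \<longrightarrow> A = B"
    and e: "e \<in> network_edges K" "A \<in> snd e" "B \<in> snd e"
  shows "A \<in> K \<and> (A = B \<or> fst e = Blue \<and> blue_adjacent K A B)"
proof -
  from e(1) obtain X Y where "X \<in> K" "Y \<in> K"
    and "e = (Red, {X, Y}) \<and> X \<cong> Y \<or> e = (Blue, {X, Y}) \<and> (large_subgroup X Y \<or> large_subgroup Y X)"
    unfolding network_edges_def by blast
  moreover from this have "X \<cong> Y \<longrightarrow> X = Y" using iso by blast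
  ultimately show ?thesis using e(2,3) by (auto simp: blue_adjacent_def)
qed

text \<open>Only \<open>m \<le> blue_length es\<close> can be expected: consecutive edges merely
  share a vertex, so a path may contain blue edges along which it does not move.\<close>

lemma path_connects_relpowp:
  assumes iso: "\<forall>A\<in>K. \<forall>B\<in>K. A \<cong> B \<longrightarrow> A = B"
    and "path_connects K es A B"
  shows "\<exists>m\<le>blue_length es. (blue_adjacent K ^^ m) A B"
  using assms(2)
proof (induction es arbitrary: A)
  case Nil
  then have "(blue_adjacent K ^^ 0) A B" by (simp add: path_connects_def)
  then show ?case by blast
next
  case (Cons e es)
  have e: "e \<in> network_edges K" "A \<in> snd e" and path: "network_path K es"
    using Cons.prems by (auto simp: path_connects_def network_path_Cons)
  obtain X m where X: "X \<in> snd e" "m \<le> blue_length es" "(blue_adjacent K ^^ m) X B"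
  proof (cases "es = []")
    case True
    then have "B \<in> snd e" using Cons.prems by (simp add: path_connects_def)
    then show ?thesis using that[of B 0] by simp
  next
    case False
    then obtain X where X: "X \<in> snd e" "X \<in> snd (hd es)"
      using Cons.prems by (auto simp: path_connects_def network_path_Cons)
    then have "path_connects K es X B"
      using Cons.prems False path by (simp add: path_connects_def)
    then show ?thesis using Cons.IH X that by blast
  qed
  from edge_blue_adjacent[OF iso e X(1)] show ?case
  proof (elim conjE disjE)
    assume "A = X"
    then show ?thesis using X by (auto simp: blue_length_def intro!: exI[of _ m])
  next
    assume "fst e = Blue" "blue_adjacent K A X"
    then show ?thesis using X relpowp_Suc_I2[of "blue_adjacent K" A X m B]
      by (auto simp: blue_length_def intro!: exI[of _ "Suc m"])
  qed
qed

lemma relpowp_path_connects: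
  assumes "(blue_adjacent K ^^ m) A B" "A \<in> K"
  shows "\<exists>es. path_connects K es A B \<and> blue_length es = m"
  using assms
proof (induction m arbitrary: A)
  case 0
  then have "path_connects K [] A B" by (simp add: path_connects_def network_path_def)
  then show ?case by (force simp: blue_length_def)
next
  case (Suc m)
  then obtain X where X: "blue_adjacent K A X" "(blue_adjacent K ^^ m) X B"
    by (meson relpowp_Suc_D2)
  then obtain es where es: "path_connects K es X B" "blue_length es = m"
    using Suc.IH unfolding blue_adjacent_def by blast
  have "(Blue, {A, X}) \<in> network_edges K"
    using X(1) unfolding network_edges_def blue_adjacent_def by blast
  then have "path_connects K ((Blue, {A, X}) # es) A B"
    using es(1) by (auto simp: path_connects_def network_path_Cons split: if_splits)
  moreover have "blue_length ((Blue, {A, X}) # es) = Suc m"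
    using es(2) by (simp add: blue_length_def)
  ultimately show ?case by blast
qed

lemma generator_distance_le_iff:
  assumes iso: "\<forall>A\<in>K. \<forall>B\<in>K. A \<cong> B \<longrightarrow> A = B" and "A \<in> K"
  shows "generator_distance K A B \<le> enat n \<longleftrightarrow> (\<exists>m\<le>n. (blue_adjacent K ^^ m) A B)"
proof
  let ?L = "(\<lambda>es. enat (blue_length es)) ` {es. path_connects K es A B}"
  assume le: "generator_distance K A B \<le> enat n"
  \<comment> \<open>The infimum of the empty set would be \<open>\<infinity>\<close>. As
    \<open>enat\<close> is well-ordered, the infimum of the non-empty set is then attained by an
    actual path.\<close>
  then have "?L \<noteq> {}" unfolding generator_distance_def by (auto simp: Inf_enat_def split: if_splits)
  then have "Inf ?L \<in> ?L" by (auto intro: wellorder_InfI)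
  then obtain es where es: "path_connects K es A B" "blue_length es \<le> n"
    using le unfolding generator_distance_def by auto
  then show "\<exists>m\<le>n. (blue_adjacent K ^^ m) A B"
    using path_connects_relpowp[OF iso es(1)] le_trans by blast
next
  assume "\<exists>m\<le>n. (blue_adjacent K ^^ m) A B"
  then obtain es where "path_connects K es A B" "blue_length es \<le> n"
    using relpowp_path_connects assms(2) by blast
  then show "generator_distance K A B \<le> enat n"
    unfolding generator_distance_def by (force intro: INF_lower2)
qed

text \<open>Moves generation from \<open>H'\<close> to the fixed ambient group \<open>G\<close>, so
  that afterwards only carriers matter.\<close>

lemma large_subgroup_iff:
  fixes G :: "'a monoid"
  assumes "group G" and H: "subgroup H G" and H': "subgroup H' G"
  shows "large_subgroup (G\<lparr>carrier := H\<rparr>) (G\<lparr>carrier := H'\<rparr>) \<longleftrightarrow>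
    H \<subseteq> H' \<and> (\<exists>h\<in>H'. generate G (insert h H) = H')"
proof (cases "H \<subseteq> H'")
  case True
  interpret group G by fact
  have "generate (G\<lparr>carrier := H'\<rparr>) (insert h H) = generate G (insert h H)" if "h \<in> H'" for h
    using generate_consistent[OF _ H'] that True by auto
  then show ?thesis
    using True subgroup_incl[OF H H'] by (auto simp: large_subgroup_def is_subgroup_of_def)
next
  case False
  then have "\<not> subgroup H (G\<lparr>carrier := H'\<rparr>)" using subgroup.subset by fastforce
  then show ?thesis using False by (simp add: large_subgroup_def is_subgroup_of_def)
qed

section \<open>Torsion and isomorphic subgroups of Q/Z\<close>

interpretation QmodZ: comm_group QmodZ
  by (rule group.group_comm_groupI[OF group_QmodZ])
    (auto simp: carrier_QmodZ mult_coset add.commute)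

lemma coset_eq_one_iff: "coset q = \<one>\<^bsub>QmodZ\<^esub> \<longleftrightarrow> q \<in> \<int>"
  by (simp add: one_QmodZ coset_eq_iff)

lemma coset_in_carrier [simp]: "coset q \<in> carrier QmodZ"
  by (simp add: carrier_QmodZ)

text \<open>Q/Z is a torsion group: the denominator of a representative annihilates its
  coset.\<close>

lemma QmodZ_pow_eq_one:
  assumes "x \<in> carrier QmodZ"
  obtains n :: nat where "n > 0" "x [^]\<^bsub>QmodZ\<^esub> n = \<one>\<^bsub>QmodZ\<^esub>"
proof -
  obtain q where q: "x = coset q" using assms by (auto simp: carrier_QmodZ)
  obtain a b where "b > 0" "q = of_int a / of_int b"
    by (metis quotient_of_denom_pos quotient_of_div surj_pair)
  then have "of_nat (nat b) * q = of_int a" by simp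
  then have "x [^]\<^bsub>QmodZ\<^esub> nat b = \<one>\<^bsub>QmodZ\<^esub>"
    unfolding q pow_coset coset_eq_one_iff by simp
  then show thesis using that[of "nat b"] \<open>b > 0\<close> by simp
qed

lemma QmodZ_ord_pos:
  assumes "x \<in> carrier QmodZ"
  shows "QmodZ.ord x > 0"
  using QmodZ_pow_eq_one[OF assms] QmodZ.pow_eq_id[OF assms] by (metis dvd_0_left gr0I less_irrefl)

text \<open>Uniqueness of the cyclic subgroup of a given order enters here: elements of equal order
  generate the same subgroup.\<close>

lemma cyclic_subgroup_ord:
  assumes "x \<in> carrier QmodZ"
  shows "cyclic_subgroup (QmodZ.ord x) = generate QmodZ {x}"
  unfolding cyclic_subgroup_def
proof (rule the1_equality[OF ex1_cyclic_subgroup[OF QmodZ_ord_pos[OF assms]]], intro conjI)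
  show "subgroup (generate QmodZ {x}) QmodZ"
    using QmodZ.generate_is_subgroup assms by simp
  show "cyclic_group (QmodZ\<lparr>carrier := generate QmodZ {x}\<rparr>)"
    using QmodZ.cyclic_group_generated[of x] assms by (simp add: subgroup_generated_def)
  show "card (generate QmodZ {x}) = QmodZ.ord x"
    using QmodZ.generate_pow_card[OF assms] by simp
qed

lemma subgroup_nat_pow_mem:
  assumes H: "subgroup H G" and x: "x \<in> H"
  shows "x [^]\<^bsub>G\<^esub> (n::nat) \<in> H"
  by (induction n) (auto simp: subgroup.one_closed[OF H] subgroup.m_closed[OF H] x nat_pow_def)

text \<open>An isomorphism preserves the order of \<open>x\<close>. Hence \<open>x\<close> and
  \<open>f x\<close> generate the same cyclic subgroup of Q/Z, and the one generated by
  \<open>f x\<close> lies in \<open>H'\<close>.\<close>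

lemma subset_if_iso:
  assumes H: "subgroup H QmodZ" and H': "subgroup H' QmodZ"
    and f: "f \<in> iso (QmodZ\<lparr>carrier := H\<rparr>) (QmodZ\<lparr>carrier := H'\<rparr>)"
  shows "H \<subseteq> H'"
proof
  fix x assume x: "x \<in> H"
  interpret f: group_hom "QmodZ\<lparr>carrier := H\<rparr>" "QmodZ\<lparr>carrier := H'\<rparr>" f
    using f QmodZ.subgroup_imp_group[OF H] QmodZ.subgroup_imp_group[OF H']
    by (simp add: group_hom_def group_hom_axioms_def iso_def)
  have inj: "inj_on f H" and fx: "f x \<in> H'"
    using f x by (auto simp: iso_def bij_betw_def)
  have carr: "x \<in> carrier QmodZ" "f x \<in> carrier QmodZ"
    using x fx subgroup.subset[OF H] subgroup.subset[OF H'] by auto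
  have pow: "f x [^]\<^bsub>QmodZ\<^esub> n = \<one>\<^bsub>QmodZ\<^esub> \<longleftrightarrow> x [^]\<^bsub>QmodZ\<^esub> n = \<one>\<^bsub>QmodZ\<^esub>" for n :: nat
  proof -
    have "f (x [^]\<^bsub>QmodZ\<^esub> n) = f x [^]\<^bsub>QmodZ\<^esub> n"
      using f.hom_nat_pow[of x n] x by (simp flip: QmodZ.nat_pow_consistent)
    moreover have "f \<one>\<^bsub>QmodZ\<^esub> = \<one>\<^bsub>QmodZ\<^esub>" using f.hom_one by simp
    moreover have "x [^]\<^bsub>QmodZ\<^esub> n \<in> H" "\<one>\<^bsub>QmodZ\<^esub> \<in> H"
      using subgroup.one_closed[OF H] subgroup_nat_pow_mem[OF H x] by simp_all
    ultimately show ?thesis using inj_onD[OF inj] by metis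
  qed
  have "QmodZ.ord x = QmodZ.ord (f x)"
    using pow QmodZ.pow_eq_id carr by (meson dvd_antisym dvd_refl)
  then have "generate QmodZ {x} = generate QmodZ {f x}"
    using cyclic_subgroup_ord carr by metis
  moreover have "x \<in> generate QmodZ {x}" by (simp add: generate.incl)
  moreover have "generate QmodZ {f x} \<subseteq> H'"
    using QmodZ.generate_subgroup_incl[OF _ H'] fx by simp
  ultimately show "x \<in> H'" by blast
qed

lemma iso_subgroups_QmodZ_eq:
  assumes "A \<in> all_subgroups QmodZ" "B \<in> all_subgroups QmodZ" "A \<cong> B"
  shows "A = B"
proof -
  obtain H H' where H: "subgroup H QmodZ" "A = QmodZ\<lparr>carrier := H\<rparr>"
    and H': "subgroup H' QmodZ" "B = QmodZ\<lparr>carrier := H'\<rparr>"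
    using assms unfolding all_subgroups_def by blast
  have "B \<cong> A" using assms(3) QmodZ.subgroup_imp_group[OF H(1)] H(2) group.iso_sym by blast
  then have "H = H'"
    using assms(3) subset_if_iso[OF H(1) H'(1)] subset_if_iso[OF H'(1) H(1)] H(2) H'(2)
    unfolding is_iso_def by blast
  then show ?thesis using H(2) H'(2) by simp
qed

section \<open>Explicit elements of Z(p^s) and of the choice subgroups\<close>

text \<open>The coset of 1/n has order n, because k/n is an integer exactly when n divides k; so its
  multiples form the cyclic subgroup.\<close>

lemma cyclic_subgroup_eq:
  assumes n: "n > 0"
  shows "cyclic_subgroup n = range (\<lambda>z. coset (of_int z / of_nat n))"
proof -
  have "coset (1 / of_nat n) [^]\<^bsub>QmodZ\<^esub> k = \<one>\<^bsub>QmodZ\<^esub> \<longleftrightarrow> n dvd k" for k :: nat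
  proof -
    have "(of_nat k / of_nat n :: rat) \<in> \<int> \<longleftrightarrow> n dvd k"
      using n by (metis (no_types) of_int_of_nat_eq of_int_div_of_int_in_Ints_iff int_dvd_int_iff
          less_irrefl of_nat_0_eq_iff)
    then show ?thesis by (simp add: pow_coset coset_eq_one_iff)
  qed
  then have "QmodZ.ord (coset (1 / of_nat n)) = n"
    using QmodZ.pow_eq_id[of "coset (1 / of_nat n)"] by (metis dvd_antisym dvd_refl coset_in_carrier)
  then show ?thesis
    using cyclic_subgroup_ord[of "coset (1 / of_nat n)"]
      QmodZ.generate_pow[of "coset (1 / of_nat n)"]
    by (auto simp: ipow_coset)
qed

text \<open>One description for finite exponents and \<open>\<infinity>\<close> spares later case
  distinctions. For \<open>k = enat t\<close>, fractions over \<open>p ^ s\<close> are expanded to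
  the denominator \<open>p ^ t\<close>.\<close>

lemma Z_sub_iff:
  assumes p: "p > 0"
  shows "x \<in> Z_sub p k \<longleftrightarrow> (\<exists>s z. enat s \<le> k \<and> x = coset (of_int z / of_nat (p ^ s)))"
proof (cases k)
  case (enat t)
  have "coset (of_int z / of_nat (p ^ s)) \<in> cyclic_subgroup (p ^ t)" if "s \<le> t" for z s
  proof -
    have "(of_int z / of_nat (p ^ s) :: rat) = of_int (z * int p ^ (t - s)) / of_nat (p ^ t)"
      using p power_add[of "of_nat p :: rat" s "t - s"] that by (simp add: field_simps)
    then show ?thesis using cyclic_subgroup_eq p by (metis rangeI zero_less_power)
  qed
  then show ?thesis using enat p by (auto simp: cyclic_subgroup_eq)
next
  case infinity
  then show ?thesis using p by (auto simp: cyclic_subgroup_eq)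
qed

lemma Z_sub_inv:
  assumes "p > 0" "x \<in> Z_sub p k"
  shows "inv\<^bsub>QmodZ\<^esub> x \<in> Z_sub p k"
proof -
  obtain s z where "enat s \<le> k" "x = coset (of_int z / of_nat (p ^ s))"
    using assms Z_sub_iff by blast
  moreover from this have "inv\<^bsub>QmodZ\<^esub> x = coset (of_int (- z) / of_nat (p ^ s))"
    by (simp add: inv_coset)
  ultimately show ?thesis using assms(1) Z_sub_iff by blast
qed

lemma Z_sub_subset_carrier: "p > 0 \<Longrightarrow> Z_sub p k \<subseteq> carrier QmodZ"
  by (auto simp: Z_sub_iff)

text \<open>Opens the way to induction over \<open>generate\<close>. The finite products already
  form a subgroup: the factors are closed under inverses, and multiplying two products concatenates
  their lists.\<close>

lemma choice_subgroup_eq_generate: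
  "choice_subgroup k = generate QmodZ (\<Union>i. Z_sub (nth_prime i) (k i))"
proof
  let ?X = "\<Union>i. Z_sub (nth_prime i) (k i)"
  have X: "?X \<subseteq> carrier QmodZ" using Z_sub_subset_carrier nth_prime_pos by blast
  have "foldr (\<otimes>\<^bsub>QmodZ\<^esub>) gs \<one>\<^bsub>QmodZ\<^esub> \<in> generate QmodZ ?X" if "set gs \<subseteq> ?X" for gs
    using that by (induction gs) (auto intro: generate.one generate.eng generate.incl)
  then show "choice_subgroup k \<subseteq> generate QmodZ ?X" unfolding choice_subgroup_def by blast
  have single: "x \<in> choice_subgroup k" if "x \<in> ?X" for x
    unfolding choice_subgroup_def using that X by (force intro!: exI[of _ "[x]"])
  show "generate QmodZ ?X \<subseteq> choice_subgroup k"
  proof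
    fix x assume "x \<in> generate QmodZ ?X"
    then show "x \<in> choice_subgroup k"
    proof induction
      case one
      \<comment> \<open>Products have at least one factor, so the identity is exhibited as a factor
        itself, as 0/1 in the component of the first prime.\<close>
      have "\<one>\<^bsub>QmodZ\<^esub> = coset (of_int 0 / of_nat (nth_prime 0 ^ 0))" by (simp add: one_QmodZ)
      then have "\<one>\<^bsub>QmodZ\<^esub> \<in> Z_sub (nth_prime 0) (k 0)"
        using Z_sub_iff[OF nth_prime_pos] by (metis zero_enat_def zero_le)
      then show ?case using single by blast
    next
      case (incl h)
      then show ?case by (rule single)
    next
      case (inv h)
      then show ?case using single Z_sub_inv[OF nth_prime_pos] by blast
    next
      case (eng h1 h2)
      then obtain gs hs where
        gs: "gs \<noteq> []" "set gs \<subseteq> ?X" "h1 = foldr (\<otimes>\<^bsub>QmodZ\<^esub>) gs \<one>\<^bsub>QmodZ\<^esub>" and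
        hs: "hs \<noteq> []" "set hs \<subseteq> ?X" "h2 = foldr (\<otimes>\<^bsub>QmodZ\<^esub>) hs \<one>\<^bsub>QmodZ\<^esub>"
        unfolding choice_subgroup_def by blast
      have closed: "foldr (\<otimes>\<^bsub>QmodZ\<^esub>) gs a \<in> carrier QmodZ"
        if "set gs \<subseteq> carrier QmodZ" "a \<in> carrier QmodZ" for gs a
        using that by (induction gs) auto
      have "foldr (\<otimes>\<^bsub>QmodZ\<^esub>) gs \<one>\<^bsub>QmodZ\<^esub> \<otimes>\<^bsub>QmodZ\<^esub> a = foldr (\<otimes>\<^bsub>QmodZ\<^esub>) gs a"
        if "set gs \<subseteq> carrier QmodZ" "a \<in> carrier QmodZ" for gs a
        using that by (induction gs) (auto simp: QmodZ.m_assoc closed)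
      moreover have "h2 \<in> carrier QmodZ" using hs X closed by auto
      ultimately have "h1 \<otimes>\<^bsub>QmodZ\<^esub> h2 = foldr (\<otimes>\<^bsub>QmodZ\<^esub>) (gs @ hs) \<one>\<^bsub>QmodZ\<^esub>"
        using gs hs X by simp
      moreover have "set (gs @ hs) \<subseteq> ?X" "gs @ hs \<noteq> []" using gs hs by auto
      ultimately show ?case unfolding choice_subgroup_def by blast
    qed
  qed
qed

lemma subgroup_choice_subgroup: "subgroup (choice_subgroup k) QmodZ"
  unfolding choice_subgroup_eq_generate
  using Z_sub_subset_carrier nth_prime_pos by (blast intro: QmodZ.generate_is_subgroup)

lemma choice_group_in_all_subgroups: "choice_group k \<in> all_subgroups QmodZ"
  using subgroup_choice_subgroup unfolding choice_group_def all_subgroups_def by blast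

lemma Z_sub_subset_choice_subgroup: "Z_sub (nth_prime i) (k i) \<subseteq> choice_subgroup k"
  unfolding choice_subgroup_eq_generate by (blast intro: generate.incl)

lemma coset_prime_power_in_choice_subgroup:
  assumes "enat s \<le> k i"
  shows "coset (1 / of_nat (nth_prime i ^ s)) \<in> choice_subgroup k"
proof -
  have "coset (of_int 1 / of_nat (nth_prime i ^ s)) \<in> Z_sub (nth_prime i) (k i)"
    using assms Z_sub_iff[OF nth_prime_pos] by blast
  then show ?thesis using Z_sub_subset_choice_subgroup by auto
qed

lemma choice_subgroup_subset_iff_Z_sub:
  assumes "subgroup H QmodZ"
  shows "choice_subgroup k \<subseteq> H \<longleftrightarrow> (\<forall>i. Z_sub (nth_prime i) (k i) \<subseteq> H)"
proof
  assume "\<forall>i. Z_sub (nth_prime i) (k i) \<subseteq> H"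
  then show "choice_subgroup k \<subseteq> H"
    unfolding choice_subgroup_eq_generate
    by (intro QmodZ.generate_subgroup_incl[OF _ assms]) blast
qed (use Z_sub_subset_choice_subgroup in blast)

section \<open>Prime parts of denominators\<close>

text \<open>The prime is fixed and the fraction need not be reduced; this makes the bound an
  invariant of the induction over \<open>generate\<close>.\<close>

lemma choice_subgroup_denominator:
  assumes "x \<in> choice_subgroup k"
  shows "\<exists>a n. n > 0 \<and> x = coset (of_int a / of_nat n) \<and> enat (multiplicity (nth_prime i) n) \<le> k i"
proof -
  have gen: "\<exists>a n. n > 0 \<and> h = coset (of_int a / of_nat n) \<and> enat (multiplicity (nth_prime i) n) \<le> k i"
    if "h \<in> (\<Union>j. Z_sub (nth_prime j) (k j))" for h
  proof -
    obtain j s z where h: "enat s \<le> k j" "h = coset (of_int z / of_nat (nth_prime j ^ s))"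
      using \<open>h \<in> _\<close> Z_sub_iff[OF nth_prime_pos] by auto
    have "multiplicity (nth_prime i) (nth_prime j ^ s) = (if i = j then s else 0)"
      using nth_prime_prime[of i] nth_prime_prime[of j] inj_nth_prime
      by (auto simp: multiplicity_distinct_prime_power inj_eq)
    then have "enat (multiplicity (nth_prime i) (nth_prime j ^ s)) \<le> k i"
      using h(1) by (auto simp flip: zero_enat_def)
    moreover have "nth_prime j ^ s > 0" using nth_prime_pos by simp
    ultimately show ?thesis using h(2) by blast
  qed
  show ?thesis
    using assms unfolding choice_subgroup_eq_generate
  proof induction
    case one
    have "\<one>\<^bsub>QmodZ\<^esub> = coset (of_int 0 / of_nat 1)" by (simp add: one_QmodZ)
    moreover have "enat (multiplicity (nth_prime i) 1) \<le> k i" by (simp flip: zero_enat_def)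
    ultimately show ?case by (metis zero_less_one)
  next
    case (incl h)
    then show ?case by (rule gen)
  next
    case (inv h)
    then have "inv\<^bsub>QmodZ\<^esub> h \<in> (\<Union>j. Z_sub (nth_prime j) (k j))"
      using Z_sub_inv[OF nth_prime_pos] by blast
    then show ?case by (rule gen)
  next
    case (eng h1 h2)
    then obtain a n b m where
      h1: "n > 0" "h1 = coset (of_int a / of_nat n)" "enat (multiplicity (nth_prime i) n) \<le> k i" and
      h2: "m > 0" "h2 = coset (of_int b / of_nat m)" "enat (multiplicity (nth_prime i) m) \<le> k i"
      by blast
    \<comment> \<open>The least common multiple, not the product, serves as common denominator: its
      multiplicity is the maximum of the two, so the bound \<open>k i\<close> persists.\<close>
    obtain c d where cd: "lcm n m = n * c" "lcm n m = m * d" by (meson dvdE dvd_lcm1 dvd_lcm2)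
    have pos: "lcm n m > 0" using h1(1) h2(1) by (simp add: lcm_pos_nat)
    then have "c > 0" "d > 0" using cd by (metis gr0I mult_0_right less_irrefl)+
    then have "(of_int a / of_nat n :: rat) = of_int (a * int c) / of_nat (n * c)"
      "(of_int b / of_nat m :: rat) = of_int (b * int d) / of_nat (m * d)"
      by simp_all
    then have "(of_int a / of_nat n + of_int b / of_nat m :: rat)
        = of_int (a * int c + b * int d) / of_nat (lcm n m)"
      unfolding cd(1)[symmetric] cd(2)[symmetric] by (simp add: add_divide_distrib)
    then have "h1 \<otimes>\<^bsub>QmodZ\<^esub> h2 = coset (of_int (a * int c + b * int d) / of_nat (lcm n m))"
      by (simp add: h1(2) h2(2) mult_coset)
    moreover have "enat (multiplicity (nth_prime i) (lcm n m)) \<le> k i"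
      using h1 h2 nth_prime_prime[of i] by (simp add: multiplicity_lcm max_def)
    ultimately show ?case using pos by blast
  qed
qed

text \<open>Clearing denominators in N/p^s = a/n + z shows that p^s divides N n; then the
  multiplicities of p are compared.\<close>

lemma choice_subgroup_prime_power_bound:
  assumes N: "N > 0" and mem: "coset (of_nat N / of_nat (nth_prime i ^ s)) \<in> choice_subgroup k"
  shows "enat s \<le> enat (multiplicity (nth_prime i) N) + k i"
proof -
  let ?p = "nth_prime i"
  obtain a n where n: "n > 0" "coset (of_nat N / of_nat (?p ^ s)) = coset (of_int a / of_nat n)"
    "enat (multiplicity ?p n) \<le> k i"
    using choice_subgroup_denominator[OF mem] by blast
  obtain z where "of_nat N / of_nat (?p ^ s) - of_int a / of_nat n = (of_int z :: rat)"
    using n(2) unfolding coset_eq_iff by (auto elim: Ints_cases)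
  then have "(of_nat N * of_nat n :: rat) = of_nat (?p ^ s) * (of_int a + of_int z * of_nat n)"
    using n(1) nth_prime_pos[of i] by (simp add: field_simps)
  then have "(of_int (int (N * n)) :: rat) = of_int (int (?p ^ s) * (a + z * int n))" by simp
  then have "int (N * n) = int (?p ^ s) * (a + z * int n)" by (simp only: of_int_eq_iff)
  then have "?p ^ s dvd N * n" by (metis dvd_triv_left int_dvd_int_iff)
  then have "s \<le> multiplicity ?p (N * n)"
    using N n(1) nth_prime_prime[of i] by (intro multiplicity_geI) (auto simp: prime_gt_1_nat)
  also have "\<dots> = multiplicity ?p N + multiplicity ?p n"
    using N n(1) nth_prime_prime[of i] by (simp add: prime_elem_multiplicity_mult_distrib)
  finally have "enat s \<le> enat (multiplicity ?p N) + enat (multiplicity ?p n)" by simp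
  then show ?thesis using n(3) by (meson add_left_mono order_trans)
qed

section \<open>Inclusion and commensurability of choice subgroups\<close>

text \<open>Additively this is N H \<subseteq> H'. Required in both directions with
  \<open>N > 0\<close>, it serves as commensurability, in a form that composes by multiplying the
  factors.\<close>

definition multiple_in :: "nat \<Rightarrow> rat set set \<Rightarrow> rat set set \<Rightarrow> bool" where
  "multiple_in N H H' \<longleftrightarrow> (\<forall>x\<in>H. x [^]\<^bsub>QmodZ\<^esub> N \<in> H')"

text \<open>Tested on the elements 1/p^s of the choice subgroup: multiplying by \<open>N\<close>
  cancels no more factors p than \<open>N\<close> contains.\<close>

lemma multiple_in_choice_subgroup:
  assumes "N > 0" "multiple_in N (choice_subgroup k) (choice_subgroup k')"
  shows "k i \<le> enat (multiplicity (nth_prime i) N) + k' i"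
proof (rule enat_le_lower)
  fix s assume "enat s \<le> k i"
  then have "coset (1 / of_nat (nth_prime i ^ s)) [^]\<^bsub>QmodZ\<^esub> N \<in> choice_subgroup k'"
    using assms(2) coset_prime_power_in_choice_subgroup unfolding multiple_in_def by blast
  then show "enat s \<le> enat (multiplicity (nth_prime i) N) + k' i"
    using choice_subgroup_prime_power_bound[OF assms(1)] by (simp add: pow_coset)
qed

lemma choice_subgroup_subset_iff: "choice_subgroup k \<subseteq> choice_subgroup k' \<longleftrightarrow> (\<forall>i. k i \<le> k' i)"
proof
  assume sub: "choice_subgroup k \<subseteq> choice_subgroup k'"
  \<comment> \<open>Inclusion is the case \<open>N = 1\<close> of the preceding bound, where all
    multiplicities vanish.\<close>
  have "x [^]\<^bsub>QmodZ\<^esub> (1::nat) = x" if "x \<in> choice_subgroup k" for x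
    using that subgroup.subset[OF subgroup_choice_subgroup] by (intro QmodZ.nat_pow_eone) blast
  then have "multiple_in 1 (choice_subgroup k) (choice_subgroup k')"
    using sub by (auto simp: multiple_in_def)
  then show "\<forall>i. k i \<le> k' i"
    using multiple_in_choice_subgroup[of 1 k k'] by (simp flip: zero_enat_def)
next
  assume le: "\<forall>i. k i \<le> k' i"
  have "Z_sub (nth_prime i) (k i) \<subseteq> Z_sub (nth_prime i) (k' i)" for i
    using le order_trans Z_sub_iff[OF nth_prime_pos] by (meson subsetI)
  then show "choice_subgroup k \<subseteq> choice_subgroup k'"
    using choice_subgroup_subset_iff_Z_sub[OF subgroup_choice_subgroup]
      Z_sub_subset_choice_subgroup by blast
qed

lemma carrier_choice_group: "carrier (choice_group k) = choice_subgroup k"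
  by (simp add: choice_group_def)

lemma choice_group_eq_iff: "choice_group k = choice_group k' \<longleftrightarrow> k = k'"
proof
  assume "choice_group k = choice_group k'"
  then have "choice_subgroup k = choice_subgroup k'" by (metis carrier_choice_group)
  then show "k = k'"
    using choice_subgroup_subset_iff[of k k'] choice_subgroup_subset_iff[of k' k]
    by (simp add: fun_eq_iff antisym)
qed simp

text \<open>The exponents differ at most by the multiplicity of the prime in \<open>N\<close>. It is
  finite, so \<open>\<infinity>\<close> occurs at the same positions, and it is zero for all but the
  finitely many primes dividing \<open>N\<close>.\<close>

lemma choice_equiv_if_commensurable:
  assumes N: "N > 0" "multiple_in N (choice_subgroup k) (choice_subgroup k')"
    "multiple_in N (choice_subgroup k') (choice_subgroup k)"
  shows "choice_equiv k k'"
proof -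
  note le = multiple_in_choice_subgroup[OF N(1,2)] multiple_in_choice_subgroup[OF N(1,3)]
  have "k i = \<infinity> \<longleftrightarrow> k' i = \<infinity>" for i using le[of i] by (cases "k i"; cases "k' i") auto
  moreover have "{i. k i \<noteq> k' i} \<subseteq> {i. nth_prime i dvd N}"
  proof clarify
    fix i assume "k i \<noteq> k' i"
    show "nth_prime i dvd N"
    proof (rule ccontr)
      assume "\<not> nth_prime i dvd N"
      then have "multiplicity (nth_prime i) N = 0" by (rule not_dvd_imp_multiplicity_0)
      then have "k i \<le> k' i" "k' i \<le> k i" using le[of i] by (simp_all flip: zero_enat_def)
      then show False using \<open>k i \<noteq> k' i\<close> by simp
    qed
  qed
  ultimately show ?thesis
    using finite_nth_prime_dvd[OF N(1)] finite_subset unfolding choice_equiv_def by blast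
qed

text \<open>Multiplication by \<open>N\<close> is an endomorphism of the abelian group that kills
  \<open>h\<close> and maps \<open>H\<close> into itself.\<close>

lemma multiple_in_generate_insert:
  assumes H: "subgroup H QmodZ" and h: "h \<in> carrier QmodZ" "h [^]\<^bsub>QmodZ\<^esub> N = \<one>\<^bsub>QmodZ\<^esub>"
  shows "multiple_in N (generate QmodZ (insert h H)) H"
proof -
  have gen: "x [^]\<^bsub>QmodZ\<^esub> N \<in> H" if "x \<in> insert h H" for x
    using that h(2) subgroup.one_closed[OF H] subgroup_nat_pow_mem[OF H] by auto
  have sub: "insert h H \<subseteq> carrier QmodZ" using h(1) subgroup.subset[OF H] by auto
  \<comment> \<open>Membership in the carrier is carried through the induction because the power
    laws for products and inverses require it.\<close>
  have "x \<in> carrier QmodZ \<and> x [^]\<^bsub>QmodZ\<^esub> N \<in> H" if "x \<in> generate QmodZ (insert h H)" for x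
    using that
  proof induction
    case one
    then show ?case using subgroup.one_closed[OF H] by simp
  next
    case (incl x)
    then show ?case using gen sub by blast
  next
    case (inv x)
    then have "x \<in> carrier QmodZ" "x [^]\<^bsub>QmodZ\<^esub> N \<in> H" using gen sub by blast+
    then show ?case using subgroup.m_inv_closed[OF H] by (simp add: QmodZ.nat_pow_inv)
  next
    case (eng x y)
    then show ?case using subgroup.m_closed[OF H] by (simp add: QmodZ.nat_pow_distrib)
  qed
  then show ?thesis unfolding multiple_in_def by blast
qed

lemma all_subgroups_carrier:
  assumes "A \<in> all_subgroups G"
  shows "carrier A \<subseteq> carrier G"
proof -
  obtain H where "subgroup H G" "A = G\<lparr>carrier := H\<rparr>"
    using assms unfolding all_subgroups_def by blast
  then show ?thesis using subgroup.subset[of H G] by simp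
qed

text \<open>An \<open>N\<close> that annihilates the additional generator works. The inclusion is
  kept in the conclusion because it later decides which choice groups can be joined by a blue
  edge.\<close>

lemma large_subgroup_multiple_in:
  assumes "A \<in> all_subgroups QmodZ" "B \<in> all_subgroups QmodZ" "large_subgroup A B"
  shows "carrier A \<subseteq> carrier B \<and> (\<exists>N>0. multiple_in N (carrier A) (carrier B) \<and>
    multiple_in N (carrier B) (carrier A))"
proof -
  obtain H H' where H: "subgroup H QmodZ" "A = QmodZ\<lparr>carrier := H\<rparr>"
    and H': "subgroup H' QmodZ" "B = QmodZ\<lparr>carrier := H'\<rparr>"
    using assms unfolding all_subgroups_def by blast
  obtain h where h: "H \<subseteq> H'" "h \<in> H'" "generate QmodZ (insert h H) = H'"
    using assms(3) large_subgroup_iff[OF group_QmodZ H(1) H'(1)] H(2) H'(2) by blast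
  have hc: "h \<in> carrier QmodZ" using h(2) subgroup.subset[OF H'(1)] by blast
  then obtain N where N: "N > 0" "h [^]\<^bsub>QmodZ\<^esub> (N::nat) = \<one>\<^bsub>QmodZ\<^esub>"
    by (rule QmodZ_pow_eq_one)
  have "multiple_in N H' H" using multiple_in_generate_insert[OF H(1) hc N(2)] h(3) by simp
  moreover have "multiple_in N H H'"
    using h(1) subgroup_nat_pow_mem[OF H'(1)] unfolding multiple_in_def by blast
  ultimately show ?thesis using N(1) h(1) H(2) H'(2) by auto
qed

text \<open>Starting from 1, the factors of the single blue steps multiply along the walk.\<close>

lemma blue_adjacent_relpowp_commensurable:
  assumes "(blue_adjacent (all_subgroups QmodZ) ^^ m) A B" "A \<in> all_subgroups QmodZ"
  shows "\<exists>N>0. multiple_in N (carrier A) (carrier B) \<and> multiple_in N (carrier B) (carrier A)"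
  using assms
proof (induction m arbitrary: B)
  case 0
  have "x [^]\<^bsub>QmodZ\<^esub> (1::nat) = x" if "x \<in> carrier A" for x
    using that all_subgroups_carrier[OF \<open>A \<in> _\<close>] by (intro QmodZ.nat_pow_eone) blast
  then show ?case using 0 by (intro exI[of _ 1]) (simp add: multiple_in_def)
next
  case (Suc m)
  then obtain X where X: "(blue_adjacent (all_subgroups QmodZ) ^^ m) A X"
    "blue_adjacent (all_subgroups QmodZ) X B" by auto
  obtain N where N: "N > 0" "multiple_in N (carrier A) (carrier X)"
    "multiple_in N (carrier X) (carrier A)"
    using Suc.IH X(1) Suc.prems(2) by blast
  obtain M where M: "M > 0" "multiple_in M (carrier X) (carrier B)"
    "multiple_in M (carrier B) (carrier X)"
    using X(2) large_subgroup_multiple_in unfolding blue_adjacent_def by metis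
  have carr: "carrier A \<subseteq> carrier QmodZ" "carrier B \<subseteq> carrier QmodZ"
    using Suc.prems(2) X(2) all_subgroups_carrier unfolding blue_adjacent_def by blast+
  have "multiple_in (N * M) (carrier A) (carrier B)" "multiple_in (N * M) (carrier B) (carrier A)"
    using N(2,3) M(2,3) carr QmodZ.nat_pow_pow unfolding multiple_in_def
    by (metis subsetD, metis subsetD mult.commute)
  then show ?case using N(1) M(1) by (metis nat_0_less_mult_iff)
qed

section \<open>Reaching a larger choice subgroup with one generator\<close>

lemma coset_dvd_closed:
  assumes H: "subgroup H QmodZ" and n: "n > 0" "coset (1 / of_nat n) \<in> H" "d dvd n"
  shows "coset (of_int z / of_nat d) \<in> H"
proof -
  obtain c where c: "n = d * c" using n(3) by blast
  then have "of_int (z * int c) * (1 / of_nat n) = (of_int z / of_nat d :: rat)" using n(1) by simp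
  then show ?thesis
    using QmodZ.subgroup_int_pow_closed[OF H n(2), of "z * int c"]
    unfolding ipow_coset by simp
qed

lemma coset_lcm_closed:
  assumes H: "subgroup H QmodZ" and n: "n > 0" "coset (1 / of_nat n) \<in> H"
    and m: "m > 0" "coset (1 / of_nat m) \<in> H"
  shows "coset (1 / of_nat (lcm n m)) \<in> H"
proof -
  \<comment> \<open>Dividing Bezout's identity by n m gives 1/lcm(n,m) = v/n + u/m.\<close>
  obtain u v where uv: "u * int n + v * int m = int (gcd n m)"
    using bezout_int[of "int n" "int m"] by auto
  have "(of_nat n * of_nat m :: rat) = of_nat (gcd n m) * of_nat (lcm n m)"
    by (metis of_nat_mult prod_gcd_lcm_nat)
  moreover have "lcm n m > 0" using n(1) m(1) by (simp add: lcm_pos_nat)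
  ultimately have "1 / of_nat (lcm n m) = (of_nat (gcd n m) / (of_nat n * of_nat m) :: rat)"
    using n(1) m(1) by (simp add: field_simps)
  also have "(of_nat (gcd n m) :: rat) = of_int u * of_nat n + of_int v * of_nat m"
    using arg_cong[OF uv, of "of_int :: int \<Rightarrow> rat"] by simp
  also have "\<dots> / (of_nat n * of_nat m) = of_int v / of_nat n + of_int u / of_nat m"
    using n(1) m(1) by (simp add: field_simps)
  finally have "coset (1 / of_nat (lcm n m)) =
      coset (of_int v / of_nat n) \<otimes>\<^bsub>QmodZ\<^esub> coset (of_int u / of_nat m)"
    by (simp add: mult_coset)
  then show ?thesis
    using coset_dvd_closed[OF H n dvd_refl] coset_dvd_closed[OF H m dvd_refl]
      subgroup.m_closed[OF H] by metis
qed

text \<open>Merges finitely many prime powers into one element 1/N. This is why a single generator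
  suffices, however many positions differ.\<close>

lemma choice_subgroup_common_denominator:
  assumes "finite F" "\<And>i. i \<in> F \<Longrightarrow> enat (s i) \<le> k i"
  shows "\<exists>N>0. coset (1 / of_nat N) \<in> choice_subgroup k \<and> (\<forall>i\<in>F. nth_prime i ^ s i dvd N)"
  using assms
proof induction
  case empty
  then show ?case
    using coset_prime_power_in_choice_subgroup[of 0 k 0]
    by (intro exI[of _ 1]) (simp flip: zero_enat_def)
next
  case (insert j F)
  then obtain N where N: "N > 0" "coset (1 / of_nat N) \<in> choice_subgroup k"
    "\<forall>i\<in>F. nth_prime i ^ s i dvd N"
    by auto
  let ?M = "lcm N (nth_prime j ^ s j)"
  have pos: "nth_prime j ^ s j > 0" using nth_prime_pos by simp
  have "coset (1 / of_nat ?M) \<in> choice_subgroup k"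
    using coset_lcm_closed[OF subgroup_choice_subgroup N(1,2) pos]
      coset_prime_power_in_choice_subgroup insert.prems by simp
  moreover have "?M > 0" using N(1) pos by (simp add: lcm_pos_nat)
  ultimately show ?case using N(3) by (metis dvd_lcm2 dvd_lcmI1 insert_iff)
qed

text \<open>The element 1/N supplies the components at the finitely many positions that differ; all
  others are already contained in \<open>choice_subgroup k\<close>.\<close>

lemma choice_le_large_subgroup:
  assumes "choice_le k k'"
  shows "large_subgroup (choice_group k) (choice_group k')"
proof -
  let ?F = "{i. k i \<noteq> k' i}"
  have fin: "finite ?F" and sub: "choice_subgroup k \<subseteq> choice_subgroup k'"
    using assms by (auto simp: choice_le_def choice_equiv_def choice_subgroup_subset_iff)
  \<comment> \<open>Since \<open>\<infinity>\<close> occurs at the same positions in both sequences,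
    \<open>k' i\<close> is finite wherever they differ, and \<open>the_enat\<close> recovers
    it.\<close>
  have k': "k' i = enat (the_enat (k' i))" if "i \<in> ?F" for i
  proof -
    have "k i = \<infinity> \<longleftrightarrow> k' i = \<infinity>" using assms by (simp add: choice_le_def choice_equiv_def)
    then show ?thesis using that by (cases "k' i") simp_all
  qed
  obtain N where N: "N > 0" "coset (1 / of_nat N) \<in> choice_subgroup k'"
    "\<forall>i\<in>?F. nth_prime i ^ the_enat (k' i) dvd N"
    using choice_subgroup_common_denominator[OF fin, of "\<lambda>i. the_enat (k' i)" k'] k' by auto
  let ?h = "coset (1 / of_nat N)" and ?H = "choice_subgroup k"
  let ?S = "generate QmodZ (insert ?h ?H)"
  have S: "subgroup ?S QmodZ"
    using subgroup.subset[OF subgroup_choice_subgroup] by (intro QmodZ.generate_is_subgroup) auto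
  have incl: "?h \<in> ?S" "?H \<subseteq> ?S" by (auto intro: generate.incl)
  have "Z_sub (nth_prime i) (k' i) \<subseteq> ?S" for i
  proof (cases "i \<in> ?F")
    case True
    have "Z_sub (nth_prime i) (k' i) = cyclic_subgroup (nth_prime i ^ the_enat (k' i))"
      using k'[OF True] by (metis Z_sub.simps(1))
    also have "\<dots> = range (\<lambda>z. coset (of_int z / of_nat (nth_prime i ^ the_enat (k' i))))"
      using nth_prime_pos by (simp only: cyclic_subgroup_eq zero_less_power)
    also have "\<dots> \<subseteq> ?S"
    proof (rule image_subsetI)
      have "nth_prime i ^ the_enat (k' i) dvd N" using N(3) True by simp
      then show "coset (of_int z / of_nat (nth_prime i ^ the_enat (k' i))) \<in> ?S" for z
        by (rule coset_dvd_closed[OF S N(1) incl(1)])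
    qed
    finally show ?thesis .
  next
    case False
    then show ?thesis using Z_sub_subset_choice_subgroup[of i k] incl(2) by auto
  qed
  then have "choice_subgroup k' \<subseteq> ?S" using choice_subgroup_subset_iff_Z_sub[OF S] by blast
  moreover have "?S \<subseteq> choice_subgroup k'"
    using QmodZ.generate_subgroup_incl[OF _ subgroup_choice_subgroup] N(2) sub by simp
  ultimately show ?thesis
    unfolding choice_group_def
    using large_subgroup_iff[OF group_QmodZ subgroup_choice_subgroup subgroup_choice_subgroup] sub N(2)
    by blast
qed

section \<open>Blue edges between choice groups and the four distances\<close>

lemma blue_adjacent_choice_group_if_le:
  assumes "choice_le k k'"
  shows "blue_adjacent (all_subgroups QmodZ) (choice_group k) (choice_group k')"
    "blue_adjacent (all_subgroups QmodZ) (choice_group k') (choice_group k)"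
  using choice_le_large_subgroup[OF assms] choice_group_in_all_subgroups
  by (auto simp: blue_adjacent_def)

lemma choice_equiv_sym:
  assumes "choice_equiv k k'"
  shows "choice_equiv k' k"
proof -
  have "{i. k' i \<noteq> k i} = {i. k i \<noteq> k' i}" by auto
  then show ?thesis using assms by (simp add: choice_equiv_def)
qed

text \<open>A blue edge gives an inclusion one way or the other, and inclusion is the pointwise
  order of exponents. This excludes distance 1 for incomparable sequences.\<close>

lemma choice_le_if_blue_adjacent:
  assumes "choice_equiv k k'"
    and "blue_adjacent (all_subgroups QmodZ) (choice_group k) (choice_group k')"
  shows "choice_le k k' \<or> choice_le k' k"
proof -
  have "choice_subgroup k \<subseteq> choice_subgroup k' \<or> choice_subgroup k' \<subseteq> choice_subgroup k"
    using assms(2) large_subgroup_multiple_in unfolding blue_adjacent_def choice_group_def by force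
  then show ?thesis
    using assms(1) choice_equiv_sym by (auto simp: choice_subgroup_subset_iff choice_le_def)
qed

text \<open>Provides the middle vertex of a path of blue-length 2. The maximum departs from
  \<open>k\<close> or \<open>k'\<close> only where these differ, and it has the same infinite
  positions.\<close>

lemma choice_le_max:
  assumes "choice_equiv k k'"
  shows "choice_le k (\<lambda>i. max (k i) (k' i))" "choice_le k' (\<lambda>i. max (k i) (k' i))"
proof -
  have "finite {i. k i \<noteq> max (k i) (k' i)}" "finite {i. k' i \<noteq> max (k i) (k' i)}"
    using assms unfolding choice_equiv_def
    by (auto elim!: finite_subset[rotated] simp: max_def split: if_splits)
  then show "choice_le k (\<lambda>i. max (k i) (k' i))" "choice_le k' (\<lambda>i. max (k i) (k' i))"
    using assms by (auto simp: choice_le_def choice_equiv_def max_def)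
qed

theorem lemma2p13:
  fixes k k' :: choice_seq
  shows
    "(k = k' \<longrightarrow>
       generator_distance (all_subgroups QmodZ) (choice_group k) (choice_group k') = 0) \<and>
     (choice_le k k' \<and> k \<noteq> k' \<longrightarrow>
       generator_distance (all_subgroups QmodZ) (choice_group k) (choice_group k') = 1) \<and>
     (choice_equiv k k' \<and> \<not> choice_le k k' \<and> \<not> choice_le k' k \<longrightarrow>
       generator_distance (all_subgroups QmodZ) (choice_group k) (choice_group k') = 2) \<and>
     (\<not> choice_equiv k k' \<longrightarrow>
       generator_distance (all_subgroups QmodZ) (choice_group k) (choice_group k') = \<infinity>)"
proof -
  let ?K = "all_subgroups QmodZ"
  let ?d = "generator_distance ?K (choice_group k) (choice_group k')"
  \<comment> \<open>Each finite value of \<open>?d\<close> is pinned down by an upper bound that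
    holds and, unless it is 0, by the next smaller bound that fails.\<close>
  have d_le: "?d \<le> enat n \<longleftrightarrow>
      (\<exists>m\<le>n. (blue_adjacent ?K ^^ m) (choice_group k) (choice_group k'))" for n
    using iso_subgroups_QmodZ_eq
    by (intro generator_distance_le_iff choice_group_in_all_subgroups ballI impI)
  have d0: "?d \<le> enat 0 \<longleftrightarrow> k = k'"
    by (simp add: d_le choice_group_eq_iff)
  have d1: "?d \<le> enat 1 \<longleftrightarrow> k = k' \<or> blue_adjacent ?K (choice_group k) (choice_group k')"
  proof -
    have "(\<exists>m\<le>1. P m) \<longleftrightarrow> P 0 \<or> P 1" for P :: "nat \<Rightarrow> bool" by (auto simp: le_Suc_eq)
    then show ?thesis by (simp add: d_le choice_group_eq_iff del: One_nat_def)
  qed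
  have "?d = 1" if "choice_le k k'" "k \<noteq> k'"
  proof -
    have "?d \<le> enat 1" using d1 blue_adjacent_choice_group_if_le(1)[OF that(1)] by blast
    moreover have "\<not> ?d \<le> enat 0" using d0 that(2) by blast
    ultimately show ?thesis by (cases ?d) (auto simp: one_enat_def)
  qed
  moreover have "?d = 2" if equiv: "choice_equiv k k'" and "\<not> choice_le k k'" "\<not> choice_le k' k"
  proof -
    let ?m = "choice_group (\<lambda>i. max (k i) (k' i))"
    have "blue_adjacent ?K (choice_group k) ?m" "blue_adjacent ?K ?m (choice_group k')"
      using choice_le_max[OF equiv] blue_adjacent_choice_group_if_le by blast+
    then have "(blue_adjacent ?K ^^ 2) (choice_group k) (choice_group k')"
      by (auto simp: numeral_2_eq_2)
    then have "?d \<le> enat 2" using d_le by blast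
    moreover have "k \<noteq> k'" using that by (auto simp: choice_le_def)
    then have "\<not> ?d \<le> enat 1" using d1 choice_le_if_blue_adjacent that by blast
    ultimately show ?thesis by (cases ?d) (auto simp: numeral_eq_enat)
  qed
  moreover have "?d = \<infinity>" if "\<not> choice_equiv k k'"
  proof (rule ccontr)
    \<comment> \<open>A finite distance yields a walk, hence commensurable choice subgroups, hence
      equivalent sequences.\<close>
    assume "?d \<noteq> \<infinity>"
    then obtain n where "?d \<le> enat n" by (metis not_infinity_eq order_refl)
    then obtain m where "(blue_adjacent ?K ^^ m) (choice_group k) (choice_group k')"
      using d_le by blast
    then obtain N where "N > 0" "multiple_in N (choice_subgroup k) (choice_subgroup k')"
      "multiple_in N (choice_subgroup k') (choice_subgroup k)"
      using blue_adjacent_relpowp_commensurable choice_group_in_all_subgroups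
      by (metis carrier_choice_group)
    then show False using choice_equiv_if_commensurable that by blast
  qed
  moreover have "?d = 0" if "k = k'" using d0 that by (simp flip: zero_enat_def)
  ultimately show ?thesis by blast
qed

end
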